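(* Let $X$ be a topological space. Let $\Xi$ be a disjoint union of open sets in $X$, each of which is homeomorphic to an open arc, and let $Z=X-\Xi$. \begin{enumerate} \item Let $g\colon B^2\to X$ be a nulhomotopy (i.e. a continuous map) such that $g(\partial B^2)\subseteq Z$. Then there is a nulhomotopy (continuous map) $g'\colon B^2\to Z$ with $g|_{\partial B^2}=g'|_{\partial B^2}$. \item Let $h\colon S^1\times[0,1]\to X$ be a homotopy between two essential curves $\gamma$ and $\gamma'$ in $Z$. Then there is a homotopy $h'$ between $\gamma$ and $\gamma'$ such that the image of $h'$ lies in $Z$. \end{enumerate}
   Context: $B^2$ is the closed unit disc with boundary $\partial B^2=S^1$. A loop is nulhomotopic (inessential) if it extends, as a map from $S^1$, to a continuous map from $B^2$, and such an extension is called a nulhomotopy of the loop; a loop is essential if it is not nulhomotopic. The homotopies in (2) are free homotopies between loops, i.e. continuous maps of the annulus $S^1\times[0,1]$ restricting to $\gamma$ and $\gamma'$ on $S^1\times\{0\}$ and $S^1\times\{1\}$. An open arc is a space homeomorphic to the open interval $(0,1)$.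
   Formalization: The space X is assumed to be Hausdorff; for arbitrary topological spaces part (1) fails, e.g. for a circle together with an open arc one of whose ends converges to every point of the circle. *)

theory Defs
  imports "HOL-Analysis.Analysis"
begin

abbreviation disc_top :: "complex topology" where
  "disc_top \<equiv> top_of_set (cball 0 1)"

abbreviation circle_top :: "complex topology" where
  "circle_top \<equiv> top_of_set (sphere 0 1)"

abbreviation annulus_top :: "(complex \<times> real) topology" where
  "annulus_top \<equiv> prod_topology circle_top (top_of_set {0..1})"

definition open_arc_space :: "'a topology \<Rightarrow> bool" where
  "open_arc_space A \<longleftrightarrow> A homeomorphic_space top_of_set {0<..<1::real}"

(* Maps are total functions on complex, so "extends" and "restricts to" mean agreement on the circle. *)

definition nulhomotopy :: "'a topology \<Rightarrow> (complex \<Rightarrow> 'a) \<Rightarrow> (complex \<Rightarrow> 'a) \<Rightarrow> bool" where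
  "nulhomotopy Y \<gamma> g \<longleftrightarrow> continuous_map disc_top Y g \<and> (\<forall>x\<in>sphere 0 1. g x = \<gamma> x)"

definition essential_loop :: "'a topology \<Rightarrow> (complex \<Rightarrow> 'a) \<Rightarrow> bool" where
  "essential_loop Y \<gamma> \<longleftrightarrow> continuous_map circle_top Y \<gamma> \<and> \<not> (\<exists>g. nulhomotopy Y \<gamma> g)"

definition free_homotopy ::
    "'a topology \<Rightarrow> (complex \<Rightarrow> 'a) \<Rightarrow> (complex \<Rightarrow> 'a) \<Rightarrow> (complex \<times> real \<Rightarrow> 'a) \<Rightarrow> bool" where
  "free_homotopy Y \<gamma> \<gamma>' h \<longleftrightarrow>
     continuous_map annulus_top Y h \<and>
     (\<forall>x\<in>sphere 0 1. h (x, 0) = \<gamma> x \<and> h (x, 1) = \<gamma>' x)"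

end

theory Submission
  imports Defs
begin

text \<open>
  Call a connected open set in the interior of the disc or annulus collapsible if its frontier is
  mapped to a single point of \<open>Z\<close>. Replacing the map on a collapsible set by that point leaves it
  continuous, and it remains to see that every point mapped into an arc lies in a collapsible set
  and that all these replacements can be made at once.

  Let \<open>U\<close> be a component of the preimage of an arc \<open>A\<close>. Since \<open>A\<close> is open in a Hausdorff space, a
  connected set that meets \<open>A\<close> and leaves it contains a whole ray towards one of the two ends of
  \<open>A\<close>. Hence each frontier point of \<open>U\<close> is sent to the limit of one of the two ends, so the frontier
  takes at most two values (\<open>frontier_of_arc_preimage_two_values\<close>). The frontier of the outer
  complementary component of \<open>U\<close> is connected, by unicoherence of the plane, so there the map takes
  only one value, and \<open>U\<close> with its holes filled in is collapsible (\<open>arc_point_in_collapsible\<close>).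

  Two collapsible sets that meet lie in a common one (\<open>collapsible_directed\<close>), so the union of all
  collapsible sets through a given point is again collapsible (\<open>collapsible_hull_at\<close>). These unions
  partition the points to be changed. The resulting map is continuous however small and numerous
  the regions are: on the way from an unchanged point to a point of a region one crosses
  the frontier of the region, where the new value is already taken by the old map
  (\<open>continuous_collapse\<close>).

  For a disc all holes may be filled. For an annulus, a filled region that swallows the inner
  disc would let the outer loop contract, first in \<open>X\<close> and then, by the case of the disc, in \<open>Z\<close>;
  essentiality of the loop excludes this (\<open>free_homotopy_avoiding_arcs\<close>).
\<close>

section \<open>Ends of an open arc\<close>

text \<open>
  If \<open>S\<close> omitted a point of the arc on both sides of one of its own points, the subarc between the
  omitted points would be relatively open in \<open>S\<close>, and relatively closed because compact sets are closed
  in a Hausdorff space.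
\<close>

lemma connected_leaving_arc_contains_ray:
  fixes X :: "'a topology" and \<psi> :: "real \<Rightarrow> 'a"
  assumes X: "Hausdorff_space X" and A: "openin X A"
    and \<psi>: "homeomorphic_map (top_of_set {0<..<1}) (subtopology X A) \<psi>"
    and S: "connectedin X S" and meets: "S \<inter> A \<noteq> {}" and leaves: "\<not> S \<subseteq> A"
  obtains s where "s \<in> {0<..<1}" "\<psi> ` {0<..s} \<subseteq> S \<or> \<psi> ` {s..<1} \<subseteq> S"
proof -
  have sub: "A \<subseteq> topspace X"
    using A by (rule openin_subset)
  have im: "\<psi> ` {0<..<1} = A"
    using homeomorphic_imp_surjective_map[OF \<psi>] sub by auto
  have inj: "inj_on \<psi> {0<..<1}"
    using homeomorphic_imp_injective_map[OF \<psi>] by simp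
  obtain s where s: "s \<in> {0<..<1}" "\<psi> s \<in> S"
    using meets im by blast
  have "\<psi> ` {0<..s} \<subseteq> S \<or> \<psi> ` {s..<1} \<subseteq> S"
  proof (rule ccontr)
    assume "\<not> ?thesis"
    then have "\<exists>a\<in>{0<..s}. \<psi> a \<notin> S" "\<exists>b\<in>{s..<1}. \<psi> b \<notin> S"
      by blast+
    then obtain a b where a: "0 < a" "a \<le> s" "\<psi> a \<notin> S" and b: "s \<le> b" "b < 1" "\<psi> b \<notin> S"
      by (metis atLeastLessThan_iff greaterThanAtMost_iff)
    have ab: "a < s" "s < b"
      using a b s by (metis order_le_imp_less_or_eq)+
    have op: "openin X (\<psi> ` {a<..<b})"
    proof -
      have "openin (top_of_set {0<..<1}) {a<..<b}"
        using a b by (intro open_subset) auto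
      then have "openin (subtopology X A) (\<psi> ` {a<..<b})"
        using homeomorphic_imp_open_map[OF \<psi>] by (simp add: open_map_def)
      then show ?thesis
        using A openin_trans_full by blast
    qed
    have cl: "closedin X (\<psi> ` {a..b})"
    proof -
      have "continuous_map (top_of_set {0<..<1}) X \<psi>"
        using homeomorphic_imp_continuous_map[OF \<psi>] by (simp add: continuous_map_in_subtopology)
      moreover have "compactin (top_of_set {0<..<1}) {a..b}"
        using a b by (auto simp: compactin_subtopology)
      ultimately show ?thesis
        using X compactin_imp_closedin image_compactin by blast
    qed
    \<comment> \<open>As \<open>S\<close> misses both end points, the open and the closed subarc cut out the same part of it.\<close>
    have eq: "\<psi> ` {a..b} \<inter> S \<subseteq> \<psi> ` {a<..<b}"
      using a b by (auto simp: less_le)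
    have *: "openin X (topspace X - \<psi> ` {a..b})"
      using cl by blast
    show False
    proof (rule connectedinD[OF S op *])
      show "S \<subseteq> \<psi> ` {a<..<b} \<union> (topspace X - \<psi> ` {a..b})"
        using eq connectedin_subset_topspace[OF S] by blast
      show "\<psi> ` {a<..<b} \<inter> (topspace X - \<psi> ` {a..b}) \<inter> S = {}"
        by fastforce
      show "\<psi> ` {a<..<b} \<inter> S \<noteq> {}"
        using s(2) ab by (metis IntI empty_iff greaterThanLessThan_iff imageI)
      have "\<psi> ` {a..b} \<subseteq> A"
        using im a b by fastforce
      then show "(topspace X - \<psi> ` {a..b}) \<inter> S \<noteq> {}"
        using leaves connectedin_subset_topspace[OF S] by blast
    qed
  qed
  then show thesis
    using that s by blast
qed

text \<open>
  Near a frontier point \<open>p\<close> of the preimage of the arc, small balls have connected images that meet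
  the arc and leave it, so they contain a ray towards one of its two ends; as the
  balls shrink, one of the ends must serve for all of them. Two points that approach the same end
  have the same image, since disjoint neighbourhoods cannot contain rays towards the same end.
\<close>

lemma frontier_of_arc_preimage_two_values:
  fixes X :: "'a topology" and g :: "'n::euclidean_space \<Rightarrow> 'a"
  assumes X: "Hausdorff_space X" and A: "openin X A" and arc: "open_arc_space (subtopology X A)"
    and K: "open K" and g: "continuous_map (top_of_set K) X g"
  obtains e0 e1 where "\<And>p. p \<in> K \<Longrightarrow> p \<in> frontier {y \<in> K. g y \<in> A} \<Longrightarrow> g p = e0 \<or> g p = e1"
proof -
  obtain \<psi> where \<psi>: "homeomorphic_map (top_of_set {0<..<1::real}) (subtopology X A) \<psi>"
    using arc unfolding open_arc_space_def
    by (meson homeomorphic_space homeomorphic_space_sym)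
  define P where "P = {y \<in> K. g y \<in> A}"
  have preim: "open {y \<in> K. g y \<in> U}" if "openin X U" for U
    using openin_continuous_map_preimage[OF g that] K by (simp add: openin_open_eq)
  define ray where "ray i s = (if i then \<psi> ` {0<..s} else \<psi> ` {s..<1})" for i :: bool and s :: real
  define nbhd where "nbhd p N \<longleftrightarrow> open N \<and> p \<in> N \<and> N \<subseteq> K" for p N
  define approaches where
    "approaches i p \<longleftrightarrow> (\<forall>N. nbhd p N \<longrightarrow> (\<exists>s\<in>{0<..<1}. ray i s \<subseteq> g ` N))" for i p
  have some_end: "approaches True p \<or> approaches False p" if p: "p \<in> K" "p \<in> frontier P" for p
  proof (rule ccontr)
    assume "\<not> ?thesis"
    then obtain N0 N1 where N: "nbhd p N0" "nbhd p N1"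
      and no: "\<And>s. s \<in> {0<..<1} \<Longrightarrow> \<not> ray True s \<subseteq> g ` N0"
        "\<And>s. s \<in> {0<..<1} \<Longrightarrow> \<not> ray False s \<subseteq> g ` N1"
      unfolding approaches_def by blast
    have "open (N0 \<inter> N1)" "p \<in> N0 \<inter> N1"
      using N by (auto simp: nbhd_def)
    then obtain r where r: "r > 0" "ball p r \<subseteq> N0 \<inter> N1"
      by (meson open_contains_ball)
    have ballK: "ball p r \<subseteq> K"
      using r N by (auto simp: nbhd_def)
    have "connectedin X (g ` ball p r)"
      using connectedin_continuous_map_image[OF g, of "ball p r"] ballK
      by (simp add: connectedin_subtopology)
    moreover have "g ` ball p r \<inter> A \<noteq> {}"
    proof -
      have "p \<in> closure P"
        using p by (simp add: frontier_def)
      then have "ball p r \<inter> P \<noteq> {}"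
        using r by (metis centre_in_ball disjoint_iff open_Int_closure_eq_empty open_ball)
      then show ?thesis
        by (auto simp: P_def)
    qed
    moreover have "\<not> g ` ball p r \<subseteq> A"
    proof -
      have "p \<notin> P"
        using p preim[OF A] frontier_disjoint_eq[of P] by (auto simp: P_def)
      then show ?thesis
        using p(1) centre_in_ball[of p r] r(1) unfolding P_def by blast
    qed
    ultimately obtain s where "s \<in> {0<..<1}" "\<psi> ` {0<..s} \<subseteq> g ` ball p r \<or> \<psi> ` {s..<1} \<subseteq> g ` ball p r"
      using connected_leaving_arc_contains_ray[OF X A \<psi>] by metis
    then show False
      using no[of s] r(2) unfolding ray_def by (simp; blast)
  qed
  have same_end: "g p = g q" if p: "p \<in> K" "approaches i p" and q: "q \<in> K" "approaches i q" for i p q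
  proof (rule ccontr)
    assume "g p \<noteq> g q"
    moreover have "g p \<in> topspace X" "g q \<in> topspace X"
      using g p q by (auto simp: continuous_map_def)
    ultimately obtain U V where UV: "openin X U" "openin X V" "g p \<in> U" "g q \<in> V" "disjnt U V"
      using X unfolding Hausdorff_space_def by blast
    have "nbhd p {y \<in> K. g y \<in> U}" "nbhd q {y \<in> K. g y \<in> V}"
      using UV p q preim by (auto simp: nbhd_def)
    then obtain s t where st: "s \<in> {0<..<1}" "ray i s \<subseteq> g ` {y \<in> K. g y \<in> U}"
        "t \<in> {0<..<1}" "ray i t \<subseteq> g ` {y \<in> K. g y \<in> V}"
      using p q unfolding approaches_def by meson
    have "ray i (if i then min s t else max s t) \<subseteq> U \<inter> V"
    proof -
      have "ray i (if i then min s t else max s t) \<subseteq> ray i s \<inter> ray i t"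
        unfolding ray_def by auto
      also have "\<dots> \<subseteq> U \<inter> V"
        using st by blast
      finally show ?thesis .
    qed
    moreover have "ray i (if i then min s t else max s t) \<noteq> {}"
      using st by (auto simp: ray_def)
    ultimately show False
      using UV by (auto simp: disjnt_def)
  qed
  have "\<exists>e. \<forall>p\<in>K. approaches i p \<longrightarrow> g p = e" for i
    using same_end by metis
  then obtain e0 e1 where "\<forall>p\<in>K. approaches True p \<longrightarrow> g p = e0" "\<forall>p\<in>K. approaches False p \<longrightarrow> g p = e1"
    by metis
  then have "\<And>p. p \<in> K \<Longrightarrow> p \<in> frontier P \<Longrightarrow> g p = e0 \<or> g p = e1"
    using some_end by blast
  then show thesis
    using that unfolding P_def by blast
qed

lemma connectedin_two_points:
  assumes X: "t1_space X" and S: "connectedin X S" "S \<subseteq> {a, b}" and xy: "x \<in> S" "y \<in> S"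
  shows "x = y"
proof (rule ccontr)
  assume ne: "x \<noteq> y"
  have "closedin X {x}" "closedin X {y}"
    using X xy connectedin_subset_topspace[OF S(1)] by (auto simp: closedin_t1_singleton)
  moreover have "S \<subseteq> {x} \<union> {y}" "{x} \<inter> {y} \<inter> S = {}" "{x} \<inter> S \<noteq> {}" "{y} \<inter> S \<noteq> {}"
    using xy S(2) ne by auto
  ultimately show False
    using S(1) unfolding connectedin_closedin by blast
qed

section \<open>Filling in bounded open sets\<close>

text \<open>
  The filling of \<open>W\<close> is written \<open>- outside W\<close>: the union of \<open>W\<close> and its holes. In dimension at least
  two a bounded set has only one unbounded complementary component, and for connected \<open>W\<close>
  unicoherence makes the frontier of that component, which is the frontier of the filling, connected.
\<close>

lemma outside_in_components_of_bounded:
  fixes W :: "'n::euclidean_space set"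
  assumes "2 \<le> DIM('n)" "bounded W"
  shows "outside W \<in> components (- W)"
  using assms by (simp add: outside_in_components connected_outside outside_bounded_nonempty)

lemma frontier_outside_subset_frontier:
  fixes W :: "'n::euclidean_space set"
  assumes "2 \<le> DIM('n)" "bounded W"
  shows "frontier (outside W) \<subseteq> frontier W"
  using frontier_of_components_subset[OF outside_in_components_of_bounded[OF assms]] by simp

lemma connected_frontier_outside:
  fixes W :: "'n::euclidean_space set"
  assumes "2 \<le> DIM('n)" "bounded W" "connected W"
  shows "connected (frontier (outside W))"
  using connected_frontier_component_complement outside_in_components_of_bounded assms by blast

lemma open_connected_filling:
  fixes W :: "'n::euclidean_space set"
  assumes "2 \<le> DIM('n)" "bounded W" "open W" "connected W"
  shows "open (- outside W)" "connected (- outside W)"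
  using outside_in_components_of_bounded[OF assms(1,2)] assms
    closed_components component_complement_connected by (blast intro: closed_Compl)+

lemma subset_filling: "W \<subseteq> - outside W"
  using outside_no_overlap by blast

text \<open>
  If the frontiers were disjoint and neither set contained the other, each frontier, being connected,
  would lie inside the other set, and the union would be open, closed and bounded.
\<close>

lemma frontiers_meet_or_nested:
  fixes V1 V2 :: "'n::euclidean_space set"
  assumes "open V1" "connected V1" "connected (frontier V1)"
    and "open V2" "connected V2" "connected (frontier V2)"
    and "bounded V1" "bounded V2" and "V1 \<inter> V2 \<noteq> {}"
  shows "frontier V1 \<inter> frontier V2 \<noteq> {} \<or> V1 \<subseteq> V2 \<or> V2 \<subseteq> V1"
proof (rule ccontr)
  assume no: "\<not> ?thesis"
  have "V1 \<inter> frontier V2 \<noteq> {}"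
    by (rule connected_Int_frontier) (use no assms in auto)
  moreover have "V2 \<inter> frontier V1 \<noteq> {}"
    by (rule connected_Int_frontier) (use no assms in auto)
  ultimately have "frontier V1 \<subseteq> V2" "frontier V2 \<subseteq> V1"
    using no connected_Int_frontier[of "frontier V1" V2] connected_Int_frontier[of "frontier V2" V1] assms
    by blast+
  then have "frontier (V1 \<union> V2) \<subseteq> V1 \<union> V2"
    using frontier_Un_subset[of V1 V2] by blast
  moreover have "frontier (V1 \<union> V2) \<inter> (V1 \<union> V2) = {}"
    using assms by (simp add: frontier_disjoint_eq open_Un)
  ultimately have "frontier (V1 \<union> V2) = {}"
    by blast
  then have "V1 \<union> V2 = UNIV"
    using assms by (auto simp: frontier_eq_empty)
  then show False
    using assms by (metis bounded_Un not_bounded_UNIV)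
qed

section \<open>Collapsing the regions on whose frontier the map is constant\<close>

text \<open>
  The map \<open>g\<close> is to be changed only inside \<open>Om\<close>. Its domain \<open>K\<close> is an open neighbourhood of
  the closure of \<open>Om\<close>, so that small balls around every point of that closure lie in the domain;
  the disc and the annulus are brought into this form by extending the map radially. The last
  assumption says that filling a region whose outer frontier has a single value does not leave
  \<open>Om\<close>; it holds trivially for a disc, and follows from essentiality of the outer loop for an
  annulus.
\<close>

locale arc_collapse =
  fixes X :: "'a topology" and \<A> :: "'a set set" and Z :: "'a set"
    and g :: "'n::euclidean_space \<Rightarrow> 'a" and K Om :: "'n set"
  assumes dim: "2 \<le> DIM('n)"
    and Hausdorff: "Hausdorff_space X"
    and disjoint_arcs: "pairwise disjnt \<A>"
    and open_arcs: "\<And>A. A \<in> \<A> \<Longrightarrow> openin X A"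
    and arcs: "\<And>A. A \<in> \<A> \<Longrightarrow> open_arc_space (subtopology X A)"
    and Z_eq: "Z = topspace X - \<Union>\<A>"
    and open_K: "open K" and open_Om: "open Om" and bounded_Om: "bounded Om"
    and closure_Om: "closure Om \<subseteq> K"
    and cont: "continuous_map (top_of_set K) X g"
    and off_Om: "\<And>x. x \<in> K - Om \<Longrightarrow> g x \<in> Z"
    and filling_in_Om: "\<And>W z. \<lbrakk>open W; connected W; W \<subseteq> Om; z \<in> Z;
        \<forall>p\<in>frontier (outside W). g p = z\<rbrakk> \<Longrightarrow> - outside W \<subseteq> Om"
begin

definition collapsible :: "'n set \<Rightarrow> bool" where
  "collapsible W \<longleftrightarrow> open W \<and> connected W \<and> W \<subseteq> Om \<and> (\<exists>z\<in>Z. \<forall>p\<in>frontier W. g p = z)"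

lemma open_preimage: "openin X U \<Longrightarrow> open {y \<in> K. g y \<in> U}"
  using openin_continuous_map_preimage[OF cont] open_K by (simp add: openin_open_eq)

lemma in_topspace: "x \<in> K \<Longrightarrow> g x \<in> topspace X"
  using cont by (auto simp: continuous_map_def)

lemma ball_into_open:
  assumes "openin X U" "p \<in> K" "g p \<in> U"
  obtains r where "r > 0" "ball p r \<subseteq> K" "g ` ball p r \<subseteq> U"
proof -
  obtain r where "r > 0" "ball p r \<subseteq> {y \<in> K. g y \<in> U}"
    using open_preimage[OF assms(1)] assms(2,3) by (auto simp: open_contains_ball)
  then show thesis
    using that by blast
qed

lemma frontier_subset_K: "W \<subseteq> Om \<Longrightarrow> frontier W \<subseteq> K"
  using closure_Om closure_mono[of W Om] by (auto simp: frontier_def)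

lemma ball_meets_frontier:
  fixes W :: "'n set"
  assumes "y \<in> ball p r" "y \<in> W" "p \<notin> W"
  obtains q where "q \<in> ball p r" "q \<in> frontier W"
proof -
  have "p \<in> ball p r"
    using assms(1) by (metis centre_in_ball mem_ball order_le_less_trans zero_le_dist)
  then have "ball p r \<inter> frontier W \<noteq> {}"
    using assms by (intro connected_Int_frontier) blast+
  then show thesis
    using that by blast
qed

lemma collapsible_filling:
  assumes "open W" "connected W" "W \<subseteq> Om" "z \<in> Z" "\<forall>p\<in>frontier (outside W). g p = z"
  shows "collapsible (- outside W)"
proof -
  have "bounded W"
    using bounded_Om assms(3) bounded_subset by blast
  then show ?thesis
    using assms filling_in_Om[OF assms] open_connected_filling[OF dim, of W]
    by (auto simp: collapsible_def)
qed

text \<open>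
  The collapsible set is the filling of the component of the preimage of the arc around \<open>x\<close>. Its
  frontier is connected and takes at most two values, hence one. The value lies in \<open>Z\<close>, because
  a frontier point mapped into another arc would have a neighbourhood mapped into that arc.
\<close>

lemma arc_point_in_collapsible:
  assumes x: "x \<in> K" "g x \<notin> Z"
  obtains W where "collapsible W" "x \<in> W"
proof -
  obtain A where A: "A \<in> \<A>" "g x \<in> A"
    using x(2) in_topspace[OF x(1)] unfolding Z_eq by blast
  define P where "P = {y \<in> K. g y \<in> A}"
  define U where "U = connected_component_set P x"
  have "open P" "x \<in> P"
    using open_preimage[OF open_arcs[OF A(1)]] x A by (auto simp: P_def)
  moreover have "y \<in> Om" if "y \<in> P" for y
    using off_Om[of y] that A(1) unfolding P_def Z_eq by blast
  ultimately have P: "open P" "x \<in> P" "P \<subseteq> Om"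
    by blast+
  have U: "open U" "connected U" "U \<subseteq> P" "x \<in> U"
    using P by (auto simp: U_def open_connected_component connected_component_subset)
  have bU: "bounded U"
    using U P bounded_Om bounded_subset by blast
  let ?F = "frontier (outside U)"
  have FU: "?F \<subseteq> frontier U"
    by (rule frontier_outside_subset_frontier[OF dim bU])
  also have "frontier U \<subseteq> frontier P"
    unfolding U_def by (rule Path_Connected.frontier_of_connected_component_subset)
  finally have FP: "?F \<subseteq> frontier P" .
  have FK: "?F \<subseteq> K"
    using FU frontier_subset_K U P by blast
  have FZ: "g p \<in> Z" if "p \<in> ?F" for p
  proof (rule ccontr)
    assume "g p \<notin> Z"
    moreover have pK: "p \<in> K"
      using that FK by blast
    ultimately obtain A' where A': "A' \<in> \<A>" "g p \<in> A'"
      using in_topspace[OF pK] unfolding Z_eq by blast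
    have "p \<notin> P"
      using that FP P frontier_disjoint_eq[of P] by blast
    then have "A' \<noteq> A"
      using A' pK by (auto simp: P_def)
    then have dj: "A' \<inter> A = {}"
      using disjoint_arcs A A' by (auto simp: pairwise_def disjnt_def)
    obtain r where r: "r > 0" "ball p r \<subseteq> K" "g ` ball p r \<subseteq> A'"
      using ball_into_open[OF open_arcs[OF A'(1)] pK A'(2)] by blast
    have "p \<in> closure P"
      using that FP by (auto simp: frontier_def)
    then have "ball p r \<inter> P \<noteq> {}"
      using r by (metis centre_in_ball disjoint_iff open_Int_closure_eq_empty open_ball)
    then show False
      using r dj by (auto simp: P_def)
  qed
  obtain e0 e1 where e: "\<And>p. p \<in> K \<Longrightarrow> p \<in> frontier P \<Longrightarrow> g p = e0 \<or> g p = e1"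
    using frontier_of_arc_preimage_two_values[OF Hausdorff open_arcs[OF A(1)] arcs[OF A(1)] open_K cont]
    unfolding P_def by metis
  have "connectedin X (g ` ?F)"
    using connectedin_continuous_map_image[OF cont, of ?F] connected_frontier_outside[OF dim bU U(2)] FK
    by (simp add: connectedin_subtopology)
  moreover have "g ` ?F \<subseteq> {e0, e1}"
    using e FK FP by blast
  ultimately have const: "g p = g q" if "p \<in> ?F" "q \<in> ?F" for p q
    using connectedin_two_points[OF Hausdorff_imp_t1_space[OF Hausdorff]] that by blast
  have "?F \<noteq> {}"
    using U subset_filling[of U] outside_bounded_nonempty[OF bU] by (auto simp: frontier_eq_empty)
  then obtain q where "q \<in> ?F"
    by blast
  then have "collapsible (- outside U)"
    using collapsible_filling[of U "g q"] U P FZ const by blast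
  then show thesis
    using that U subset_filling by blast
qed

text \<open>
  After filling, either one set contains the other or their frontiers share a point. In the
  second case both frontiers carry the same value, so the union is collapsible.
\<close>

lemma collapsible_directed:
  assumes W: "collapsible W1" "collapsible W2" and x: "x \<in> W1" "x \<in> W2"
  obtains W where "collapsible W" "W1 \<union> W2 \<subseteq> W"
proof -
  have filled: "collapsible (- outside W) \<and> connected (frontier (- outside W)) \<and> W \<subseteq> - outside W"
    if cW: "collapsible W" for W
  proof -
    have bW: "bounded W"
      using cW bounded_Om bounded_subset by (auto simp: collapsible_def)
    obtain z where z: "z \<in> Z" "\<forall>p\<in>frontier W. g p = z"
      using cW by (auto simp: collapsible_def)
    have W: "open W" "connected W" "W \<subseteq> Om"
      using cW by (auto simp: collapsible_def)
    have "\<forall>p\<in>frontier (outside W). g p = z"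
      using z frontier_outside_subset_frontier[OF dim bW] by blast
    then have "collapsible (- outside W)"
      by (rule collapsible_filling[OF W z(1)])
    then show ?thesis
      using connected_frontier_outside[OF dim bW W(2)] subset_filling[of W] by simp
  qed
  define V1 V2 where "V1 = - outside W1" and "V2 = - outside W2"
  have V: "collapsible V1" "connected (frontier V1)" "W1 \<subseteq> V1"
    "collapsible V2" "connected (frontier V2)" "W2 \<subseteq> V2"
    using filled[OF W(1)] filled[OF W(2)] by (auto simp: V1_def V2_def)
  have "frontier V1 \<inter> frontier V2 \<noteq> {} \<or> V1 \<subseteq> V2 \<or> V2 \<subseteq> V1"
    using V x bounded_Om bounded_subset
    by (intro frontiers_meet_or_nested) (auto simp: collapsible_def)
  moreover have "collapsible (V1 \<union> V2)" if meet: "frontier V1 \<inter> frontier V2 \<noteq> {}"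
  proof -
    obtain z1 z2 where z: "z1 \<in> Z" "z2 \<in> Z" "\<forall>p\<in>frontier V1. g p = z1" "\<forall>p\<in>frontier V2. g p = z2"
      using V by (auto simp: collapsible_def)
    then have "\<forall>p\<in>frontier (V1 \<union> V2). g p = z1"
      using meet frontier_Un_subset[of V1 V2] by (metis IntE UnE ex_in_conv subsetD)
    moreover have "connected (V1 \<union> V2)"
      using V x by (intro connected_Un) (auto simp: collapsible_def)
    ultimately show ?thesis
      using V z by (auto simp: collapsible_def)
  qed
  ultimately show thesis
    using that V by (metis Un_mono sup.absorb1 sup.absorb2)
qed

definition hull_at :: "'n \<Rightarrow> 'n set" where
  "hull_at x = \<Union>{W. collapsible W \<and> x \<in> W}"

text \<open>
  Near a frontier point \<open>p\<close> of the union there are points of some member through \<open>x\<close>, but \<open>p\<close> is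
  in none, so frontier points of members lie arbitrarily close to \<open>p\<close>. For two frontier points
  \<open>p\<close> and \<open>q\<close>, directedness supplies one member serving both; its single frontier value is then
  close to both \<open>g p\<close> and \<open>g q\<close>, which therefore cannot be separated.
\<close>

lemma collapsible_hull_at:
  assumes W: "collapsible W" "x \<in> W"
  shows "collapsible (hull_at x)"
proof -
  let ?M = "hull_at x"
  have op: "open ?M"
    by (auto simp: hull_at_def collapsible_def)
  have conn: "connected ?M"
    unfolding hull_at_def by (rule connected_Union) (auto simp: collapsible_def)
  have sub: "?M \<subseteq> Om"
    by (auto simp: hull_at_def collapsible_def)
  have FK: "frontier ?M \<subseteq> K"
    using sub by (rule frontier_subset_K)
  have FM: "p \<notin> ?M" "p \<in> closure ?M" if "p \<in> frontier ?M" for p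
    using that op frontier_disjoint_eq[of ?M] by (auto simp: frontier_def)
  have meets: "\<exists>V. collapsible V \<and> x \<in> V \<and> ball p r \<inter> V \<noteq> {}" if "p \<in> frontier ?M" "r > 0" for p r
  proof -
    have "ball p r \<inter> ?M \<noteq> {}"
      using FM(2)[OF that(1)] that(2)
      by (metis centre_in_ball disjoint_iff open_Int_closure_eq_empty open_ball)
    then show ?thesis
      by (auto simp: hull_at_def)
  qed
  have near: "\<exists>q\<in>ball p r. q \<in> frontier V" if "p \<in> frontier ?M" "collapsible V" "x \<in> V" "ball p r \<inter> V \<noteq> {}" for p r V
  proof -
    have "V \<subseteq> ?M"
      using that(2,3) by (auto simp: hull_at_def)
    then have "p \<notin> V"
      using FM(1)[OF that(1)] by blast
    moreover obtain y where "y \<in> ball p r" "y \<in> V"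
      using \<open>ball p r \<inter> V \<noteq> {}\<close> by blast
    ultimately show ?thesis
      using ball_meets_frontier[of y p r V] by blast
  qed
  have const: "g p = g q" if p: "p \<in> frontier ?M" and q: "q \<in> frontier ?M" for p q
  proof (rule ccontr)
    assume "g p \<noteq> g q"
    then obtain O1 O2 where O: "openin X O1" "openin X O2" "g p \<in> O1" "g q \<in> O2" "disjnt O1 O2"
      using Hausdorff in_topspace p q FK unfolding Hausdorff_space_def by (meson subsetD)
    obtain r s where r: "r > 0" "g ` ball p r \<subseteq> O1" and s: "s > 0" "g ` ball q s \<subseteq> O2"
      using ball_into_open[OF O(1) _ O(3)] ball_into_open[OF O(2) _ O(4)] p q FK by (metis subsetD)
    obtain V1 V2 where V: "collapsible V1" "x \<in> V1" "ball p r \<inter> V1 \<noteq> {}"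
      "collapsible V2" "x \<in> V2" "ball q s \<inter> V2 \<noteq> {}"
      using meets[OF p r(1)] meets[OF q s(1)] by blast
    obtain V where V': "collapsible V" "V1 \<union> V2 \<subseteq> V"
      using collapsible_directed V by metis
    obtain p' q' where "p' \<in> ball p r" "p' \<in> frontier V" "q' \<in> ball q s" "q' \<in> frontier V"
      using near[OF p V'(1), of r] near[OF q V'(1), of s] V V' by blast
    moreover from this have "g p' = g q'"
      using V' by (auto simp: collapsible_def)
    ultimately have "g p' \<in> O1" "g p' \<in> O2"
      using r(2) s(2) by (blast, metis image_subset_iff)
    then show False
      using O(5) by (auto simp: disjnt_def)
  qed
  have inZ: "g p \<in> Z" if p: "p \<in> frontier ?M" for p
  proof (rule ccontr)
    assume gp: "g p \<notin> Z"
    have pK: "p \<in> K"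
      using p FK by blast
    have "g p \<in> \<Union>\<A>"
      using gp in_topspace[OF pK] Z_eq by blast
    moreover have "openin X (\<Union>\<A>)"
      using open_arcs by (rule openin_Union)
    ultimately obtain r where r: "r > 0" "g ` ball p r \<subseteq> \<Union>\<A>"
      using ball_into_open[of "\<Union>\<A>" p] pK by metis
    obtain V where V: "collapsible V" "x \<in> V" "ball p r \<inter> V \<noteq> {}"
      using meets[OF p r(1)] by blast
    then obtain q where q: "q \<in> ball p r" "q \<in> frontier V"
      using near[OF p] by blast
    have "g q \<in> Z"
      using V(1) q(2) by (auto simp: collapsible_def)
    moreover have "g q \<in> \<Union>\<A>"
      using r(2) q(1) by (rule subsetD[OF _ imageI])
    ultimately show False
      by (simp add: Z_eq)
  qed
  obtain z where "z \<in> Z" "\<forall>p\<in>frontier ?M. g p = z"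
  proof (cases "frontier ?M = {}")
    case True
    then show ?thesis
      using W that by (auto simp: collapsible_def)
  next
    case False
    then show ?thesis
      using inZ const that by blast
  qed
  then show ?thesis
    using op conn sub by (auto simp: collapsible_def)
qed

lemma hull_at_eq:
  assumes "collapsible W" "x \<in> W" "y \<in> hull_at x"
  shows "hull_at y = hull_at x"
proof -
  have cx: "collapsible (hull_at x)"
    by (rule collapsible_hull_at[OF assms(1,2)])
  have cy: "collapsible (hull_at y)"
    by (rule collapsible_hull_at[OF cx assms(3)])
  have 1: "hull_at x \<subseteq> hull_at y"
    using cx assms(3) by (auto simp: hull_at_def[of y])
  have "x \<in> hull_at x"
    using assms by (auto simp: hull_at_def)
  then have "hull_at y \<subseteq> hull_at x"
    using 1 cy by (auto simp: hull_at_def[of x])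
  with 1 show ?thesis
    by blast
qed

definition collapse :: "'n \<Rightarrow> 'a" where
  "collapse x = (if \<exists>W. collapsible W \<and> x \<in> W then g (SOME p. p \<in> frontier (hull_at x)) else g x)"

text \<open>Any frontier point of the hull may stand for the chosen one, since \<open>g\<close> is constant there.\<close>

lemma collapse_on_hull:
  assumes W: "collapsible W" "x \<in> W" and p: "p \<in> frontier (hull_at x)"
  shows "collapse x = g p" "collapse x \<in> Z"
proof -
  have "(SOME p. p \<in> frontier (hull_at x)) \<in> frontier (hull_at x)"
    using p by (rule someI)
  moreover obtain z where "z \<in> Z" "\<forall>p\<in>frontier (hull_at x). g p = z"
    using collapsible_hull_at[OF W] by (auto simp: collapsible_def)
  moreover have "collapse x = g (SOME p. p \<in> frontier (hull_at x))"
    using W by (auto simp: collapse_def)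
  ultimately show "collapse x = g p" "collapse x \<in> Z"
    using p by auto
qed

lemma frontier_hull_at_nonempty:
  assumes "collapsible W" "x \<in> W"
  shows "frontier (hull_at x) \<noteq> {}"
proof -
  have "hull_at x \<subseteq> Om"
    using collapsible_hull_at[OF assms] by (auto simp: collapsible_def)
  then have "hull_at x \<noteq> UNIV"
    using bounded_Om bounded_subset not_bounded_UNIV by metis
  then show ?thesis
    using assms by (auto simp: frontier_eq_empty hull_at_def)
qed

lemma collapse_in_Z:
  assumes "x \<in> K"
  shows "collapse x \<in> Z"
proof (cases "\<exists>W. collapsible W \<and> x \<in> W")
  case True
  then show ?thesis
    using collapse_on_hull frontier_hull_at_nonempty by blast
next
  case False
  then show ?thesis
    using arc_point_in_collapsible[OF assms] by (auto simp: collapse_def)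
qed

lemma collapse_off_Om: "x \<notin> Om \<Longrightarrow> collapse x = g x"
  by (auto simp: collapse_def collapsible_def)

text \<open>
  On a hull the new map is constant. At a point \<open>p\<close> outside all hulls, a ball on which \<open>g\<close> stays
  in a given neighbourhood of \<open>g p\<close> works for the new map as well: if it meets a hull, it
  meets the frontier of that hull, where \<open>g\<close> has the value taken on the hull.
\<close>

lemma continuous_collapse: "continuous_map (top_of_set K) (subtopology X Z) collapse"
proof -
  have nbhd: "\<exists>N. open N \<and> p \<in> N \<and> N \<subseteq> {x \<in> K. collapse x \<in> U}"
    if U: "openin X U" and p: "p \<in> K" "collapse p \<in> U" for U p
  proof (cases "\<exists>W. collapsible W \<and> p \<in> W")
    case True
    then obtain W where W: "collapsible W" "p \<in> W"
      by blast
    obtain q where q: "q \<in> frontier (hull_at p)"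
      using frontier_hull_at_nonempty[OF W] by blast
    have M: "collapsible (hull_at p)"
      by (rule collapsible_hull_at[OF W])
    have "collapse y \<in> U" if "y \<in> hull_at p" for y
      using collapse_on_hull(1)[OF W q] collapse_on_hull(1)[OF M that, of q] hull_at_eq[OF W that] q p(2)
      by simp
    moreover have "hull_at p \<subseteq> K" "open (hull_at p)" "p \<in> hull_at p"
      using M W closure_Om closure_subset[of Om] by (auto simp: collapsible_def hull_at_def)
    ultimately show ?thesis
      by (intro exI[of _ "hull_at p"]) (simp add: subset_iff)
  next
    case False
    then have "collapse p = g p"
      by (auto simp: collapse_def)
    then have "g p \<in> U"
      using p(2) by simp
    then obtain r where r: "r > 0" "ball p r \<subseteq> K" "g ` ball p r \<subseteq> U"
      using ball_into_open[OF U p(1)] by blast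
    have "collapse x \<in> U" if x: "x \<in> ball p r" for x
    proof (cases "\<exists>W. collapsible W \<and> x \<in> W")
      case True
      then obtain W where W: "collapsible W" "x \<in> W"
        by blast
      have "x \<in> hull_at x" "p \<notin> hull_at x"
        using W False by (auto simp: hull_at_def)
      then obtain q where "q \<in> ball p r" "q \<in> frontier (hull_at x)"
        using ball_meets_frontier x by metis
      then show ?thesis
        using collapse_on_hull(1)[OF W] r by auto
    next
      case False
      then have "collapse x = g x"
        by (auto simp: collapse_def)
      then show ?thesis
        using x r(3) by auto
    qed
    then have "ball p r \<subseteq> {x \<in> K. collapse x \<in> U}"
      using r(2) by blast
    then show ?thesis
      using r(1) by (meson centre_in_ball open_ball)
  qed
  have "open {x \<in> K. collapse x \<in> U}" if "openin X U" for U
  proof (subst open_subopen, intro ballI)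
    fix p
    assume "p \<in> {x \<in> K. collapse x \<in> U}"
    then show "\<exists>N. open N \<and> p \<in> N \<and> N \<subseteq> {x \<in> K. collapse x \<in> U}"
      using nbhd[OF that] by simp
  qed
  then have "continuous_map (top_of_set K) X collapse"
    using collapse_in_Z Z_eq open_K by (auto simp: continuous_map_def openin_open_eq)
  then show ?thesis
    using collapse_in_Z by (auto simp: continuous_map_in_subtopology)
qed

end

section \<open>Discs and annuli\<close>

lemma nulhomotopy_avoiding_arcs:
  fixes X :: "'a topology" and g :: "complex \<Rightarrow> 'a"
  assumes X: "Hausdorff_space X" and disj: "pairwise disjnt \<A>"
    and op: "\<And>A. A \<in> \<A> \<Longrightarrow> openin X A"
    and arc: "\<And>A. A \<in> \<A> \<Longrightarrow> open_arc_space (subtopology X A)"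
    and Z: "Z = topspace X - \<Union>\<A>"
    and g: "continuous_map disc_top X g" and bd: "g ` sphere 0 1 \<subseteq> Z"
  obtains g' where "continuous_map disc_top (subtopology X Z) g'" "\<forall>x\<in>sphere 0 1. g x = g' x"
proof -
  \<comment> \<open>The radial retraction onto the disc extends the map to the whole plane, with values in \<open>Z\<close> off the disc.\<close>
  define \<rho> :: "complex \<Rightarrow> complex" where "\<rho> w = w /\<^sub>R max 1 (norm w)" for w
  have n\<rho>: "norm (\<rho> w) = norm w / max 1 (norm w)" for w
    by (simp add: \<rho>_def divide_inverse_commute abs_of_nonneg)
  have "continuous_on UNIV \<rho>"
    unfolding \<rho>_def by (intro continuous_intros) auto
  moreover have "\<rho> w \<in> cball 0 1" for w
    using n\<rho>[of w] by (simp add: divide_le_eq max_def)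
  ultimately have "continuous_map (top_of_set UNIV) disc_top \<rho>"
    by (simp add: continuous_map_in_subtopology image_subset_iff)
  then have cont: "continuous_map (top_of_set UNIV) X (g \<circ> \<rho>)"
    using g continuous_map_compose by blast
  have off: "(g \<circ> \<rho>) w \<in> Z" if "w \<in> UNIV - ball 0 1" for w
  proof -
    have "\<rho> w \<in> sphere 0 1"
      using that n\<rho>[of w] by (auto simp: max_def)
    then show ?thesis
      using bd by auto
  qed
  interpret arc_collapse X \<A> Z "g \<circ> \<rho>" UNIV "ball 0 1"
  proof
    show "- outside W \<subseteq> ball 0 1" if "W \<subseteq> ball 0 1" for W :: "complex set"
      using outside_mono[OF that] outside_convex[OF convex_ball, of "0::complex" 1] by blast
  qed (use X disj op arc Z cont off in auto)
  have "\<forall>x\<in>sphere 0 1. g x = collapse x"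
    using collapse_off_Om by (simp add: \<rho>_def)
  moreover have "continuous_map disc_top (subtopology X Z) collapse"
    using continuous_collapse by (simp add: continuous_map_from_subtopology)
  ultimately show thesis
    using that by blast
qed

lemma continuous_constant_on_open_extension:
  fixes X :: "'a topology" and g :: "'b::topological_space \<Rightarrow> 'a"
  assumes V: "open V" and g: "continuous_map (top_of_set (- V)) X g"
    and z: "z \<in> topspace X" and fr: "\<forall>p\<in>frontier V. g p = z"
  shows "continuous_map euclidean X (\<lambda>w. if w \<in> V then z else g w)"
proof (rule continuous_map_cases)
  have "{x. x \<notin> V} = - V"
    by auto
  then show "continuous_map (subtopology euclidean (euclidean closure_of {x. x \<notin> V})) X g"
    using g V by (simp add: closed_Compl)
qed (use z fr in auto)

text \<open>
  The annulus is placed in the plane between the circles of radius 1 and 2. If a filling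
  whose frontier has a single value contained the origin, giving that value to the whole filling
  would extend the outer loop over the disc of radius 2. The filling therefore misses the origin, hence the inner disc, which is connected and
  disjoint from \<open>W\<close>, and stays in the open annulus.
\<close>

lemma free_homotopy_avoiding_arcs:
  fixes X :: "'a topology" and h :: "complex \<times> real \<Rightarrow> 'a"
  assumes X: "Hausdorff_space X" and disj: "pairwise disjnt \<A>"
    and op: "\<And>A. A \<in> \<A> \<Longrightarrow> openin X A"
    and arc: "\<And>A. A \<in> \<A> \<Longrightarrow> open_arc_space (subtopology X A)"
    and Z: "Z = topspace X - \<Union>\<A>"
    and \<gamma>: "continuous_map circle_top (subtopology X Z) \<gamma>"
    and \<gamma>': "essential_loop (subtopology X Z) \<gamma>'"
    and h: "free_homotopy X \<gamma> \<gamma>' h"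
  obtains h' where "free_homotopy X \<gamma> \<gamma>' h'" "h' ` (sphere 0 1 \<times> {0..1}) \<subseteq> Z"
proof -
  \<comment> \<open>Polar coordinates, with the radius clamped so that \<open>h \<circ> \<sigma>\<close> continues the two loops radially off the annulus.\<close>
  define \<sigma> :: "complex \<Rightarrow> complex \<times> real" where
    "\<sigma> w = (w /\<^sub>R norm w, max 0 (min 1 (norm w - 1)))" for w
  let ?K = "- {0} :: complex set"
  let ?Om = "ball 0 2 - cball 0 1 :: complex set"
  have "continuous_on ?K \<sigma>"
    unfolding \<sigma>_def by (intro continuous_intros) auto
  moreover have "\<sigma> ` ?K \<subseteq> sphere 0 1 \<times> {0..1}"
    by (auto simp: \<sigma>_def)
  moreover have annulus: "annulus_top = top_of_set (sphere 0 1 \<times> {0..1})"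
    by simp
  ultimately have "continuous_map (top_of_set ?K) annulus_top \<sigma>"
    by (simp add: continuous_map_in_subtopology image_subset_iff_funcset)
  then have cont: "continuous_map (top_of_set ?K) X (h \<circ> \<sigma>)"
    using h continuous_map_compose unfolding free_homotopy_def by blast
  have inner: "(h \<circ> \<sigma>) w = \<gamma> (w /\<^sub>R norm w)" if "w \<noteq> 0" "norm w \<le> 1" for w
    using h that by (simp add: free_homotopy_def \<sigma>_def)
  have outer: "(h \<circ> \<sigma>) w = \<gamma>' (w /\<^sub>R norm w)" if "norm w \<ge> 2" for w
  proof -
    have "w \<noteq> 0"
      using that by auto
    then show ?thesis
      using h that by (simp add: free_homotopy_def \<sigma>_def)
  qed
  have inZ: "\<gamma> x \<in> Z" "\<gamma>' x \<in> Z" if "x \<in> sphere 0 1" for x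
    using that \<gamma> \<gamma>' by (auto simp: essential_loop_def continuous_map_in_subtopology)
  have off: "(h \<circ> \<sigma>) w \<in> Z" if "w \<in> ?K - ?Om" for w
  proof -
    have "w \<noteq> 0" "norm w \<le> 1 \<or> norm w \<ge> 2"
      using that by auto
    moreover from this have "w /\<^sub>R norm w \<in> sphere 0 1"
      by simp
    ultimately show ?thesis
      using inner outer inZ by metis
  qed
  have filling: "- outside W \<subseteq> ?Om"
    if W: "open W" "connected W" "W \<subseteq> ?Om" "z \<in> Z" "\<forall>p\<in>frontier (outside W). (h \<circ> \<sigma>) p = z"
    for W z
  proof -
    let ?V = "- outside W"
    have bW: "bounded W"
      using W(3) bounded_subset[OF bounded_ball] by blast
    have Vball: "?V \<subseteq> ball 0 2"
      using outside_mono[of W "ball 0 2"] W(3) outside_convex[OF convex_ball, of "0::complex" 2] by blast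
    have V: "open ?V"
      using open_connected_filling[OF _ bW] W by simp
    have "0 \<notin> ?V"
    proof
      assume "0 \<in> ?V"
      then have "continuous_map (top_of_set (- ?V)) X (h \<circ> \<sigma>)"
        using cont by (auto intro: continuous_map_from_subtopology_mono)
      then have "continuous_map euclidean X (\<lambda>w. if w \<in> ?V then z else (h \<circ> \<sigma>) w)"
        using continuous_constant_on_open_extension[OF V, of X "h \<circ> \<sigma>" z] W(4,5) Z by simp
      moreover have "continuous_map disc_top euclidean (\<lambda>x::complex. 2 * x)"
        by (auto intro!: continuous_intros)
      ultimately have F: "continuous_map disc_top X ((\<lambda>w. if w \<in> ?V then z else (h \<circ> \<sigma>) w) \<circ> (\<lambda>x. 2 * x))"
        (is "continuous_map _ _ ?F")
        using continuous_map_compose by blast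
      have bd: "?F x = \<gamma>' x" if "x \<in> sphere 0 1" for x
      proof -
        have "2 * x \<notin> ?V"
          using Vball that by (auto simp: norm_mult subset_iff)
        moreover have "(h \<circ> \<sigma>) (2 * x) = \<gamma>' x"
          using outer[of "2 * x"] that by (simp add: norm_mult scaleR_conv_of_real)
        ultimately show ?thesis
          by simp
      qed
      then have "?F ` sphere 0 1 \<subseteq> Z"
        using inZ by force
      then obtain g' where "continuous_map disc_top (subtopology X Z) g'" "\<forall>x\<in>sphere 0 1. ?F x = g' x"
        using nulhomotopy_avoiding_arcs[OF X disj op arc Z F] by blast
      then have "nulhomotopy (subtopology X Z) \<gamma>' g'"
        using bd by (simp add: nulhomotopy_def)
      then show False
        using \<gamma>' by (auto simp: essential_loop_def)
    qed
    moreover have "outside W \<in> components (- W)"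
      using outside_in_components_of_bounded[OF _ bW] by simp
    moreover have "0 \<in> cball (0::complex) 1"
      by simp
    moreover have "cball 0 1 \<subseteq> - W"
      using W(3) by blast
    ultimately have "cball 0 1 \<subseteq> outside W"
      using components_maximal[of "outside W" "- W" "cball 0 1"] by blast
    then show ?thesis
      using Vball by blast
  qed
  interpret arc_collapse X \<A> Z "h \<circ> \<sigma>" ?K ?Om
  proof (unfold_locales, simp, rule X, rule disj, erule op, erule arc, rule Z)
    have "closure ?Om \<subseteq> - ball 0 1"
      by (intro closure_minimal) auto
    then show "closure ?Om \<subseteq> ?K"
      by auto
    show "bounded ?Om"
      by (rule bounded_subset[OF bounded_ball Diff_subset])
    show "continuous_map (top_of_set ?K) X (h \<circ> \<sigma>)"
      by (rule cont)
    show "open ?K" "open ?Om"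
      by (simp_all add: open_Diff open_Compl)
  qed (fact off filling)+
  define h' where "h' = collapse \<circ> (\<lambda>(x, t). (1 + t) *\<^sub>R x)"
  have dom: "(1 + t) *\<^sub>R x \<in> ?K" if "x \<in> sphere 0 1" "t \<in> {0..1}" for x :: complex and t :: real
    using that by auto
  have "continuous_on (sphere 0 1 \<times> {0..1}) (\<lambda>(x, t). (1 + t) *\<^sub>R x :: complex)"
    unfolding case_prod_unfold by (intro continuous_intros)
  then have "continuous_map annulus_top (top_of_set ?K) (\<lambda>(x, t). (1 + t) *\<^sub>R x)"
    using dom unfolding annulus by (auto simp: continuous_map_in_subtopology)
  then have "continuous_map annulus_top (subtopology X Z) h'"
    unfolding h'_def using continuous_collapse continuous_map_compose by blast
  then have h': "continuous_map annulus_top X h'"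
    by (simp add: continuous_map_in_subtopology)
  have "h' (x, 0) = \<gamma> x \<and> h' (x, 1) = \<gamma>' x" if x: "x \<in> sphere 0 1" for x
  proof -
    have "x \<noteq> 0"
      using x by auto
    then have "collapse x = \<gamma> x"
      using collapse_off_Om[of x] inner[of x] x by simp
    moreover have "collapse (2 *\<^sub>R x) = \<gamma>' x"
      using collapse_off_Om[of "2 *\<^sub>R x"] outer[of "2 *\<^sub>R x"] x by simp
    ultimately show ?thesis
      by (simp add: h'_def)
  qed
  then have "free_homotopy X \<gamma> \<gamma>' h'"
    using h' by (simp add: free_homotopy_def)
  moreover have "h' ` (sphere 0 1 \<times> {0..1}) \<subseteq> Z"
    using dom collapse_in_Z by (auto simp: h'_def)
  ultimately show thesis
    using that by blast
qed

theorem lemma4p3: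
  fixes X :: "'a topology" and \<A> :: "'a set set" and \<Xi> Z :: "'a set"
  assumes "Hausdorff_space X"
    and "pairwise disjnt \<A>"
    and "\<And>A. A \<in> \<A> \<Longrightarrow> openin X A"
    and "\<And>A. A \<in> \<A> \<Longrightarrow> open_arc_space (subtopology X A)"
    and "\<Xi> = \<Union>\<A>"
    and "Z = topspace X - \<Xi>"
  shows "(\<forall>g. continuous_map disc_top X g \<and> g ` sphere 0 1 \<subseteq> Z \<longrightarrow>
            (\<exists>g'. continuous_map disc_top (subtopology X Z) g' \<and>
                  (\<forall>x\<in>sphere 0 1. g x = g' x))) \<and>
         (\<forall>\<gamma> \<gamma>' h. essential_loop (subtopology X Z) \<gamma> \<and>
            essential_loop (subtopology X Z) \<gamma>' \<and>
            free_homotopy X \<gamma> \<gamma>' h \<longrightarrow>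
            (\<exists>h'. free_homotopy X \<gamma> \<gamma>' h' \<and> h' ` (sphere 0 1 \<times> {0..1}) \<subseteq> Z))"
proof (intro conjI allI impI; (elim conjE)?)
  fix g
  assume "continuous_map disc_top X g" "g ` sphere 0 1 \<subseteq> Z"
  then show "\<exists>g'. continuous_map disc_top (subtopology X Z) g' \<and> (\<forall>x\<in>sphere 0 1. g x = g' x)"
    using nulhomotopy_avoiding_arcs[OF assms(1-4), of Z g] assms(5,6) by metis
next
  fix \<gamma> \<gamma>' h
  assume "essential_loop (subtopology X Z) \<gamma>" "essential_loop (subtopology X Z) \<gamma>'"
    "free_homotopy X \<gamma> \<gamma>' h"
  then show "\<exists>h'. free_homotopy X \<gamma> \<gamma>' h' \<and> h' ` (sphere 0 1 \<times> {0..1}) \<subseteq> Z"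
    using free_homotopy_avoiding_arcs[OF assms(1-4), of Z \<gamma> \<gamma>' h] assms(5,6)
    unfolding essential_loop_def by metis
qed

end
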